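(* Let $\mathbb{F}$ be an arbitrary field and let $m\ge 1$. Each $\mathrm{GL}_2(\mathbb{F})$-orbit on $\mathcal{N}_2^m$ contains one and only one element of the following types: (0) $(0,\ldots,0)$; (1) $(\alpha_1E_{12},\ldots,\alpha_mE_{12})$, where at least one element of the list $\alpha_1,\ldots,\alpha_m\in\mathbb{F}$ is non-zero, and $\alpha_v=1$ for $v=\min\{1\le i\le m\mid\alpha_i\ne0\}$; (2) $(\alpha_1E_{12},\ldots,\alpha_rE_{12},\alpha_{r+1}E_{21},D_1,\ldots,D_s)$, where $1\le r\le m-1$ and $s=m-r-1$; $\alpha_1,\ldots,\alpha_r\in\mathbb{F}$ with at least one element of $\{\alpha_1,\ldots,\alpha_r\}$ non-zero, and $\alpha_{r+1}\in\mathbb{F}^\times$; $\alpha_v=1$ for $v=\min\{1\le i\le r\mid\alpha_i\ne0\}$; and $D_i\in\mathcal{N}_2$ for every $1\le i\le s$.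
   Context: $\mathcal{N}_2$ is the set of all nilpotent $2\times2$ matrices over $\mathbb{F}$. The group $\mathrm{GL}_2(\mathbb{F})$ acts on $\mathcal{N}_2^m$ by simultaneous conjugation: $g\cdot(A_1,\ldots,A_m)=(gA_1g^{-1},\ldots,gA_mg^{-1})$. $E_{ij}$ is the $2\times 2$ matrix with $(i,j)$-th entry $1$ and the remaining entries $0$. $\mathbb{F}^\times=\mathbb{F}\setminus\{0\}$. *)

theory Defs
  imports "HOL-Analysis.Analysis"
begin

type_synonym 'a mat2 = "'a^2^2"

(* The library makes vectors (hence matrices) an instance of times with the
   componentwise product, so powers must be built from the matrix product. *)
primrec mat_pow :: "'a::semiring_1^'n^'n \<Rightarrow> nat \<Rightarrow> 'a^'n^'n" where
  "mat_pow A 0 = mat 1"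
| "mat_pow A (Suc k) = A ** mat_pow A k"

definition nilpotent_mat :: "'a::semiring_1^'n^'n \<Rightarrow> bool" where
  "nilpotent_mat A \<longleftrightarrow> (\<exists>k. mat_pow A k = 0)"

definition nilp2 :: "'a::field mat2 set" where
  "nilp2 = {A. nilpotent_mat A}"

(* The index type 2 has the two elements 1 and 2 (with 2 = 0). *)
definition mat_unit :: "2 \<Rightarrow> 2 \<Rightarrow> 'a::field mat2" where
  "mat_unit i j = (\<chi> k l. if k = i \<and> l = j then 1 else 0)"

definition mat_scale :: "'a::field \<Rightarrow> 'a mat2 \<Rightarrow> 'a mat2" where
  "mat_scale c A = (\<chi> k l. c * A $ k $ l)"

(* m-tuples are lists of length m; the i-th component of As is As ! (i - 1). *)
definition nilp2_tuples :: "nat \<Rightarrow> 'a::field mat2 list set" where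
  "nilp2_tuples m = {As. length As = m \<and> set As \<subseteq> nilp2}"

definition simul_conj :: "'a::field mat2 \<Rightarrow> 'a mat2 list \<Rightarrow> 'a mat2 list" where
  "simul_conj g As = map (\<lambda>A. g ** A ** matrix_inv g) As"

definition GL2_orbit :: "'a::field mat2 list \<Rightarrow> 'a mat2 list set" where
  "GL2_orbit As = {simul_conj g As | g. invertible g}"

definition GL2_orbits :: "nat \<Rightarrow> 'a::field mat2 list set set" where
  "GL2_orbits m = GL2_orbit ` nilp2_tuples m"

definition first_nonzero_is_one :: "'a::field list \<Rightarrow> bool" where
  "first_nonzero_is_one as \<longleftrightarrow>
     (\<exists>a\<in>set as. a \<noteq> 0) \<and> as ! Min {i. i < length as \<and> as ! i \<noteq> 0} = 1"

definition type0 :: "nat \<Rightarrow> 'a::field mat2 list set" where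
  "type0 m = {replicate m 0}"

definition type1 :: "nat \<Rightarrow> 'a::field mat2 list set" where
  "type1 m = {map (\<lambda>a. mat_scale a (mat_unit 1 2)) as | as.
     length as = m \<and> first_nonzero_is_one as}"

definition type2 :: "nat \<Rightarrow> 'a::field mat2 list set" where
  "type2 m = {map (\<lambda>a. mat_scale a (mat_unit 1 2)) as @ [mat_scale b (mat_unit 2 1)] @ Ds
     | as b Ds r s. 1 \<le> r \<and> r \<le> m - 1 \<and> s = m - r - 1
         \<and> length as = r \<and> first_nonzero_is_one as \<and> b \<noteq> 0
         \<and> length Ds = s \<and> set Ds \<subseteq> nilp2}"

end

theory Submission
  imports Defs
begin

text \<open>For invertible \<open>g\<close>, the relation \<open>B = g A g\<^sup>-\<^sup>1\<close> is the polynomial identity \<open>g A = B g\<close>, which can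
  be compared entry by entry. A matrix intertwining \<open>E\<^sub>1\<^sub>2\<close> with itself is upper triangular with
  constant diagonal; hence once the first nonzero component has been moved to \<open>E\<^sub>1\<^sub>2\<close>, all multiples
  of \<open>E\<^sub>1\<^sub>2\<close> are fixed by what remains of the group. The first component with a nonzero lower left
  entry \<open>c\<close> can be moved to \<open>c E\<^sub>2\<^sub>1\<close> by a unique unipotent upper triangular matrix, and after that
  only scalar matrices remain, which act trivially.\<close>

section \<open>Two-by-two matrices and nilpotency, entry by entry\<close>

lemma mat2_eq_iff:
  fixes A B :: "'a^2^2"
  shows "A = B \<longleftrightarrow> A$1$1 = B$1$1 \<and> A$1$2 = B$1$2 \<and> A$2$1 = B$2$1 \<and> A$2$2 = B$2$2"
  by (auto simp: vec_eq_iff forall_2)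

lemma mat2_mult_entry:
  fixes A B :: "'a::semiring_1^2^2"
  shows "(A ** B)$i$j = A$i$1 * B$1$j + A$i$2 * B$2$j"
  by (simp add: matrix_matrix_mult_def sum_2)

definition mat2_of :: "'a \<Rightarrow> 'a \<Rightarrow> 'a \<Rightarrow> 'a \<Rightarrow> 'a^2^2" where
  "mat2_of a b c d = (\<chi> i j. if i = 1 then (if j = 1 then a else b) else (if j = 1 then c else d))"

lemma mat2_of_entry [simp]:
  "mat2_of a b c d $ 1 $ 1 = a" "mat2_of a b c d $ 1 $ 2 = b"
  "mat2_of a b c d $ 2 $ 1 = c" "mat2_of a b c d $ 2 $ 2 = d"
  by (auto simp: mat2_of_def)

lemma mat_scale_entry [simp]: "mat_scale c A $ i $ j = c * A $ i $ j"
  by (simp add: mat_scale_def)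

lemma mat_unit_entry [simp]: "mat_unit i j $ k $ l = (if k = i \<and> l = j then 1 else 0)"
  by (simp add: mat_unit_def)

lemmas mat2_simps = mat2_eq_iff mat2_mult_entry

lemma invertible_mat2_of:
  fixes a b c d :: "'a::field"
  assumes "a * d - b * c \<noteq> 0"
  shows "invertible (mat2_of a b c d)"
  using assms by (simp add: invertible_det_nz det_2)

text \<open>Multiplicativity of the determinant gives \<open>det A = 0\<close>, so Cayley-Hamilton
  reads \<open>A ** A = t A\<close> with \<open>t\<close> the trace. Hence the power with exponent
  \<open>n + 1\<close> is \<open>t ^ n\<close> times \<open>A\<close>, and nilpotency forces
  \<open>t = 0\<close>. The conclusions are trace zero and determinant zero.\<close>

lemma nilp2_entries:
  fixes A :: "'a::field mat2"
  assumes "A \<in> nilp2"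
  shows "A$2$2 = - A$1$1" and "A$1$2 * A$2$1 = - (A$1$1 * A$1$1)"
proof -
  obtain k where k: "mat_pow A k = 0"
    using assms by (auto simp: nilp2_def nilpotent_mat_def)
  have "det (mat_pow A k) = det A ^ k"
    by (induction k) (auto simp: det_mul det_I)
  with k have "det A = 0"
    by (cases k) (auto simp: det_2 mat2_simps mat_def)
  then have det: "A$1$1 * A$2$2 = A$1$2 * A$2$1"
    by (simp add: det_2)
  define t where "t = A$1$1 + A$2$2"
  have sq: "A ** A = mat_scale t A"
    using det by (simp add: mat2_simps t_def algebra_simps)
  have "mat_pow A (Suc n) = mat_scale (t ^ n) A" for n
  proof (induction n)
    case 0
    show ?case by (simp add: mat2_eq_iff)
  next
    case (Suc n)
    have "A ** mat_scale (t ^ n) A = mat_scale (t ^ n) (A ** A)"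
      by (simp add: mat2_simps algebra_simps)
    with Suc show ?case
      by (simp add: sq) (simp add: mat2_eq_iff algebra_simps)
  qed
  \<comment> \<open>One further factor makes the exponent positive, as the formula above
    requires.\<close>
  moreover have "mat_pow A (Suc k) = 0"
    by (simp add: k)
  ultimately have "t = 0 \<or> A = 0"
    by (auto simp: mat2_eq_iff)
  then have "t = 0"
    by (auto simp: t_def)
  then show tr: "A$2$2 = - A$1$1"
    by (simp add: t_def add_eq_0_iff)
  show "A$1$2 * A$2$1 = - (A$1$1 * A$1$1)"
    using det by (simp add: tr)
qed

section \<open>Conjugation as intertwining, and orbits\<close>

lemma matrix_inv_mult:
  assumes "invertible g"
  shows "g ** matrix_inv g = mat 1" and "matrix_inv g ** g = mat 1"
  using someI_ex[OF assms[unfolded invertible_def]] by (auto simp: matrix_inv_def)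

lemma conj_eq_iff_intertwine:
  fixes g A B :: "'a::field mat2"
  assumes "invertible g"
  shows "g ** A ** matrix_inv g = B \<longleftrightarrow> g ** A = B ** g"
  using assms
  by (metis matrix_inv_mult matrix_mul_assoc matrix_mul_rid)

lemma simul_conj_eq_iff:
  fixes g :: "'a::field mat2"
  assumes "invertible g"
  shows "simul_conj g As = Bs \<longleftrightarrow> list_all2 (\<lambda>A B. g ** A = B ** g) As Bs"
  using conj_eq_iff_intertwine[OF assms]
  by (auto simp: simul_conj_def list_all2_conv_all_nth list_eq_iff_nth_eq)

lemma mem_GL2_orbit_iff:
  "Bs \<in> GL2_orbit As \<longleftrightarrow> (\<exists>g. invertible g \<and> list_all2 (\<lambda>A B. g ** A = B ** g) As Bs)"
  by (auto simp: GL2_orbit_def simul_conj_eq_iff[symmetric])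

lemma GL2_orbit_sym:
  assumes "Bs \<in> GL2_orbit As"
  shows "As \<in> GL2_orbit Bs"
proof -
  obtain g where g: "invertible g" "list_all2 (\<lambda>A B. g ** A = B ** g) As Bs"
    using assms by (auto simp: mem_GL2_orbit_iff)
  have "matrix_inv g ** B = A ** matrix_inv g" if "g ** A = B ** g" for A B
    using that g(1)
    by (metis matrix_inv_mult matrix_mul_assoc matrix_mul_rid matrix_mul_lid)
  then have "list_all2 (\<lambda>A B. matrix_inv g ** A = B ** matrix_inv g) Bs As"
    using g(2) by (auto simp: list_all2_conv_all_nth)
  moreover have "invertible (matrix_inv g)"
    using g(1) by (metis invertible_def matrix_inv_mult)
  ultimately show ?thesis
    by (auto simp: mem_GL2_orbit_iff)
qed

lemma GL2_orbit_trans: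
  assumes "Bs \<in> GL2_orbit As" "Cs \<in> GL2_orbit Bs"
  shows "Cs \<in> GL2_orbit As"
proof -
  obtain g h where g: "invertible g" "list_all2 (\<lambda>A B. g ** A = B ** g) As Bs"
    and h: "invertible h" "list_all2 (\<lambda>A B. h ** A = B ** h) Bs Cs"
    using assms by (auto simp: mem_GL2_orbit_iff)
  have "(h ** g) ** A = C ** (h ** g)" if "g ** A = B ** g" "h ** B = C ** h" for A B C
    using that by (metis matrix_mul_assoc)
  then have "list_all2 (\<lambda>A B. (h ** g) ** A = B ** (h ** g)) As Cs"
    by (intro list_all2_trans[OF _ g(2) h(2)])
  then show ?thesis
    using g(1) h(1) by (auto simp: mem_GL2_orbit_iff intro!: invertible_mult exI[of _ "h ** g"])
qed

text \<open>The relation \<open>g ** A = B ** g\<close> passes to powers, and the invertible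
  \<open>g\<close> cancels. This keeps the unconstrained tail of a normal form inside
  \<open>nilp2\<close>.\<close>

lemma GL2_orbit_nilp2_tuples:
  assumes "As \<in> nilp2_tuples m" "Bs \<in> GL2_orbit As"
  shows "Bs \<in> nilp2_tuples m"
proof -
  obtain g where g: "invertible g" "list_all2 (\<lambda>A B. g ** A = B ** g) As Bs"
    using assms(2) by (auto simp: mem_GL2_orbit_iff)
  have "B \<in> nilp2" if A: "A \<in> nilp2" and AB: "g ** A = B ** g" for A B
  proof -
    obtain k where "mat_pow A k = 0"
      using A by (auto simp: nilp2_def nilpotent_mat_def)
    moreover have "g ** mat_pow A k = mat_pow B k ** g"
      proof (induction k)
      case (Suc k)
      then show ?case
        by simp (metis AB matrix_mul_assoc)
    qed simp
    ultimately have "mat_pow B k ** g = 0"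
      by (simp add: mat2_simps)
    then have "mat_pow B k ** (g ** matrix_inv g) = 0"
      by (simp add: matrix_mul_assoc)
    then have "mat_pow B k = 0"
      using g(1) by (simp add: matrix_inv_mult)
    then show ?thesis
      by (auto simp: nilp2_def nilpotent_mat_def)
  qed
  then have "list_all2 (\<lambda>A B. A \<in> nilp2 \<longrightarrow> B \<in> nilp2) As Bs"
    by (intro list_all2_mono[OF g(2)]) blast
  then show ?thesis
    using assms(1)
    by (auto simp: nilp2_tuples_def list_all2_conv_all_nth subset_code(1) all_set_conv_all_nth)
qed

section \<open>Normal forms as lists\<close>

lemma first_nonzero_is_one_iff:
  "first_nonzero_is_one as \<longleftrightarrow> (\<exists>n bs. as = replicate n 0 @ 1 # bs)"
proof -
  \<comment> \<open>The minimum is the length of the initial block of zeros. The entry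
    \<open>b\<close> is only assumed nonzero, because one direction has yet to derive
    \<open>b = 1\<close>.\<close>
  have Min: "Min {i. i < length xs \<and> xs ! i \<noteq> 0} = n"
    if "xs = replicate n 0 @ b # bs" "b \<noteq> 0" for xs bs :: "'a list" and b n
    using that by (intro Min_eqI) (auto simp: nth_append not_less[symmetric])
  show ?thesis
  proof
    assume as: "first_nonzero_is_one as"
    then obtain ys b bs where "as = ys @ b # bs" "b \<noteq> 0" "\<forall>y\<in>set ys. y = 0"
      unfolding first_nonzero_is_one_def using split_list_first_prop[of as "\<lambda>x. x \<noteq> 0"] by blast
    moreover from this have "ys = replicate (length ys) 0"
      by (simp add: replicate_length_same)
    ultimately have eq: "as = replicate (length ys) 0 @ b # bs"
      by metis
    with Min[OF this \<open>b \<noteq> 0\<close>] as have "b = 1"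
      by (simp add: first_nonzero_is_one_def nth_append)
    with eq show "\<exists>n bs. as = replicate n 0 @ 1 # bs"
      by blast
  next
    assume "\<exists>n bs. as = replicate n 0 @ 1 # bs"
    then obtain n bs where "as = replicate n 0 @ 1 # bs" by blast
    with Min[OF this] show "first_nonzero_is_one as"
      by (simp add: first_nonzero_is_one_def nth_append)
  qed
qed

abbreviation scaled_E12 :: "'a::field \<Rightarrow> 'a mat2" where
  "scaled_E12 a \<equiv> mat_scale a (mat_unit 1 2)"

abbreviation scaled_E21 :: "'a::field \<Rightarrow> 'a mat2" where
  "scaled_E21 a \<equiv> mat_scale a (mat_unit 2 1)"

text \<open>Treats both nonzero types uniformly: type (1) is the case of an empty tail
  \<open>Cs\<close>. The bounds on \<open>r\<close> become automatic, since a list with a nonzero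
  entry is nonempty and the total length is \<open>m\<close>.\<close>

lemma type1_or_type2_iff:
  "As \<in> type1 m \<or> As \<in> type2 m \<longleftrightarrow>
     (\<exists>as Cs. As = map scaled_E12 as @ Cs \<and> first_nonzero_is_one as \<and> length As = m \<and>
        (Cs = [] \<or> (\<exists>b Ds. Cs = scaled_E21 b # Ds \<and> b \<noteq> 0 \<and> set Ds \<subseteq> nilp2)))"
  (is "_ \<longleftrightarrow> ?R")
proof
  assume "As \<in> type1 m \<or> As \<in> type2 m"
  then show ?R
  proof
    assume "As \<in> type1 m"
    then show ?R by (force simp: type1_def)
  next
    assume "As \<in> type2 m"
    then obtain as b Ds where "As = map scaled_E12 as @ scaled_E21 b # Ds"
      "first_nonzero_is_one as" "b \<noteq> 0" "set Ds \<subseteq> nilp2"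
      "1 \<le> length as" "length as \<le> m - 1" "length Ds = m - length as - 1"
      by (auto simp: type2_def)
    then show ?R
      by (intro exI[of _ as] exI[of _ "scaled_E21 b # Ds"]) auto
  qed
next
  assume ?R
  then obtain as Cs where As: "As = map scaled_E12 as @ Cs" "first_nonzero_is_one as" "length As = m"
    and Cs: "Cs = [] \<or> (\<exists>b Ds. Cs = scaled_E21 b # Ds \<and> b \<noteq> 0 \<and> set Ds \<subseteq> nilp2)"
    by blast
  from Cs show "As \<in> type1 m \<or> As \<in> type2 m"
  proof
    assume "Cs = []"
    with As show ?thesis by (auto simp: type1_def)
  next
    assume "\<exists>b Ds. Cs = scaled_E21 b # Ds \<and> b \<noteq> 0 \<and> set Ds \<subseteq> nilp2"
    then obtain b Ds where b: "Cs = scaled_E21 b # Ds" "b \<noteq> 0" "set Ds \<subseteq> nilp2"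
      by blast
    have "1 \<le> length as"
      using As(2) by (cases as) (auto simp: first_nonzero_is_one_def)
    with As b have "As \<in> type2 m"
      unfolding type2_def
      by (intro CollectI exI[of _ as] exI[of _ b] exI[of _ Ds] exI[of _ "length as"]
          exI[of _ "length Ds"]) auto
    then show ?thesis ..
  qed
qed

section \<open>Moving a tuple to a normal form\<close>

lemma nilp2_intertwine_E12:
  fixes A :: "'a::field mat2"
  assumes "A \<in> nilp2" "A \<noteq> 0"
  obtains g where "invertible g" "g ** A = scaled_E12 1 ** g"
proof (cases "A$2$1 = 0")
  case True
  with nilp2_entries[OF assms(1)] assms(2)
  have "invertible (mat2_of 1 0 0 (A$1$2))" "A$1$1 = 0" "A$2$2 = 0"
    by (auto intro!: invertible_mat2_of simp: mat2_eq_iff)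
  with True show ?thesis
    by (intro that) (auto simp: mat2_simps)
next
  case False
  \<comment> \<open>The rows of the witness are the second unit row vector and its product with
    \<open>A\<close>. One more multiplication by \<open>A\<close> gives zero because
    \<open>A ** A = 0\<close>, which is the action of \<open>E12\<close> on rows.\<close>
  then have "invertible (mat2_of 0 1 (A$2$1) (A$2$2))"
    by (intro invertible_mat2_of) auto
  with nilp2_entries[OF assms(1)] show ?thesis
    by (intro that) (auto simp: mat2_simps algebra_simps)
qed

text \<open>If the lower left entry vanishes, determinant zero makes the square of
  \<open>A$1$1\<close> vanish, and trace zero then kills the whole diagonal.\<close>

lemma nilp2_eq_scaled_E12_iff:
  fixes A :: "'a::field mat2"
  assumes "A \<in> nilp2"
  shows "(\<exists>a. A = scaled_E12 a) \<longleftrightarrow> A$2$1 = 0"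
  using nilp2_entries[OF assms] by (auto simp: mat2_eq_iff)

text \<open>Conjugation by a shear with upper right entry \<open>x\<close> turns
  \<open>A$1$1\<close> into \<open>A$1$1 + x * A$2$1\<close> and keeps \<open>A$2$1\<close>;
  \<open>x\<close> is chosen to make the former zero. Trace and determinant then clear the other
  entries. The shear commutes with \<open>E12\<close>, so a prefix already normalized is not
  disturbed.\<close>

lemma nilp2_intertwine_E21:
  fixes A :: "'a::field mat2"
  assumes "A \<in> nilp2" "A$2$1 \<noteq> 0"
  obtains g where "invertible g" "g ** A = scaled_E21 (A$2$1) ** g"
    "\<And>a. g ** scaled_E12 a = scaled_E12 a ** g"
proof
  let ?g = "mat2_of 1 (- A$1$1 / A$2$1) 0 1"
  show "invertible ?g"
    by (intro invertible_mat2_of) auto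
  show "?g ** A = scaled_E21 (A$2$1) ** ?g"
    using nilp2_entries[OF assms(1)] assms(2) by (auto simp: mat2_simps field_simps)
  show "?g ** scaled_E12 a = scaled_E12 a ** ?g" for a
    by (auto simp: mat2_simps)
qed

lemma GL2_orbit_representative_exists:
  assumes "As \<in> nilp2_tuples m"
  shows "\<exists>Bs \<in> GL2_orbit As. Bs \<in> type0 m \<or> Bs \<in> type1 m \<or> Bs \<in> type2 m"
proof (cases "\<forall>A\<in>set As. A = 0")
  case True
  then have "As = replicate (length As) 0"
    by (simp add: replicate_length_same)
  with assms have "As \<in> type0 m"
    by (simp add: type0_def nilp2_tuples_def)
  moreover have "As \<in> GL2_orbit As"
    unfolding mem_GL2_orbit_iff
    by (intro exI[of _ "mat 1"]) (auto simp: list_all2_conv_all_nth invertible_det_nz)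
  ultimately show ?thesis by blast
next
  case False
  then obtain Zs A Bs where As: "As = Zs @ A # Bs" "A \<noteq> 0" "\<forall>Z\<in>set Zs. Z = 0"
    using split_list_first_prop[of As "\<lambda>A. A \<noteq> 0"] by blast
  then have Zs: "Zs = replicate (length Zs) 0"
    by (simp add: replicate_length_same)
  have "A \<in> nilp2"
    using assms As(1) by (auto simp: nilp2_tuples_def)
  then obtain g where g: "invertible g" "g ** A = scaled_E12 1 ** g"
    using As(2) by (rule nilp2_intertwine_E12)
  define n where "n = length Zs"
  define Bs' where "Bs' = simul_conj g Bs"
  \<comment> \<open>The leading zeros are written as multiples of \<open>E12\<close>, so that this
    part is already the beginning of a normal-form prefix.\<close>
  let ?As' = "map scaled_E12 (replicate n 0 @ [1]) @ Bs'"
  have "scaled_E12 0 = (0 :: 'a mat2)"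
    by (simp add: mat2_eq_iff)
  then have orb: "?As' \<in> GL2_orbit As"
  proof -
    have "list_all2 (\<lambda>A B. g ** A = B ** g) Bs Bs'"
      by (simp add: Bs'_def simul_conj_eq_iff[OF g(1), symmetric])
    moreover have "list_all2 (\<lambda>A B. g ** A = B ** g) Zs (replicate n 0)"
      by (subst Zs) (auto simp: n_def mat2_simps intro!: list_all2_all_nthI)
    ultimately have "list_all2 (\<lambda>A B. g ** A = B ** g) As ?As'"
      using g(2) \<open>scaled_E12 0 = 0\<close> by (auto simp: As(1) intro!: list_all2_appendI)
    with g(1) show ?thesis
      unfolding mem_GL2_orbit_iff by blast
  qed
  have tup: "?As' \<in> nilp2_tuples m"
    using GL2_orbit_nilp2_tuples[OF assms orb] .
  then have nil: "set Bs' \<subseteq> nilp2"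
    by (simp add: nilp2_tuples_def)
  have mults: "\<exists>as. Cs = map scaled_E12 as" if "set Cs \<subseteq> nilp2" "\<forall>C\<in>set Cs. C$2$1 = 0" for Cs :: "'a mat2 list"
    using that nilp2_eq_scaled_E12_iff unfolding ex_map_conv by blast
  show ?thesis
  proof (cases "\<forall>B\<in>set Bs'. B$2$1 = 0")
    case True
    then obtain bs where "Bs' = map scaled_E12 bs"
      using mults nil by blast
    then have "?As' = map scaled_E12 (replicate n 0 @ 1 # bs)"
      by simp
    then have "?As' \<in> type1 m \<or> ?As' \<in> type2 m"
      unfolding type1_or_type2_iff first_nonzero_is_one_iff using tup
      by (intro exI[of _ "replicate n 0 @ 1 # bs"] exI[of _ "[]"]) (auto simp: nilp2_tuples_def)
    with orb show ?thesis by blast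
  next
    case False
    \<comment> \<open>\<open>B\<close> is the first component outside the line spanned by
      \<open>E12\<close>; it fixes where the prefix ends.\<close>
    then obtain Xs B Ys where Bs': "Bs' = Xs @ B # Ys" "B$2$1 \<noteq> 0" "\<forall>X\<in>set Xs. X$2$1 = 0"
      using split_list_first_prop[of Bs' "\<lambda>B. B$2$1 \<noteq> 0"] by blast
    obtain bs where bs: "Xs = map scaled_E12 bs"
      using mults[of Xs] nil Bs' by auto
    have "B \<in> nilp2"
      using nil Bs' by auto
    then obtain h where h: "invertible h" "h ** B = scaled_E21 (B$2$1) ** h"
      "\<And>a. h ** scaled_E12 a = scaled_E12 a ** h"
      using Bs'(2) by (rule nilp2_intertwine_E21) blast
    let ?as = "replicate n 0 @ 1 # bs"
    let ?As'' = "map scaled_E12 ?as @ scaled_E21 (B$2$1) # simul_conj h Ys"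
    have eq: "?As' = map scaled_E12 ?as @ B # Ys"
      by (simp add: Bs' bs)
    have "list_all2 (\<lambda>A B. h ** A = B ** h) Ys (simul_conj h Ys)"
      by (simp add: simul_conj_eq_iff[OF h(1), symmetric])
    moreover have "list_all2 (\<lambda>A B. h ** A = B ** h) (map scaled_E12 ?as) (map scaled_E12 ?as)"
      by (intro list_all2_all_nthI) (simp_all only: length_map nth_map h(3))
    ultimately have "list_all2 (\<lambda>A B. h ** A = B ** h) (map scaled_E12 ?as @ B # Ys) ?As''"
      using h(2) by (intro list_all2_appendI) simp_all
    with h(1) have "?As'' \<in> GL2_orbit ?As'"
      unfolding mem_GL2_orbit_iff eq by (intro exI[of _ h] conjI)
    then have orb': "?As'' \<in> GL2_orbit As"
      using orb GL2_orbit_trans by blast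
    have "?As'' \<in> nilp2_tuples m"
      using GL2_orbit_nilp2_tuples[OF assms orb'] .
    then have "?As'' \<in> type1 m \<or> ?As'' \<in> type2 m"
      unfolding type1_or_type2_iff first_nonzero_is_one_iff
      by (intro exI[of _ ?as] exI[of _ "scaled_E21 (B$2$1) # simul_conj h Ys"])
        (use Bs'(2) in \<open>auto simp: nilp2_tuples_def\<close>)
    with orb' show ?thesis by blast
  qed
qed

section \<open>Uniqueness of the normal form\<close>

lemma intertwine_E12_E12D:
  fixes g :: "'a::field mat2"
  assumes "g ** scaled_E12 1 = scaled_E12 1 ** g" "invertible g"
  shows "g$2$1 = 0" "g$1$1 = g$2$2" "g$2$2 \<noteq> 0"
  using assms by (auto simp: mat2_simps invertible_det_nz det_2)

text \<open>Comparing positions from the left shrinks the possible \<open>g\<close>: the leading 1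
  makes it upper triangular with constant diagonal, and the \<open>E21\<close> component, if there
  is one, makes it scalar. The hypothesis \<open>le\<close> fixes one of two symmetric
  cases.\<close>

lemma intertwined_normal_forms_eq:
  fixes as as' :: "'a::field list"
  assumes g: "invertible g"
    and tw: "list_all2 (\<lambda>A B. g ** A = B ** g) (map scaled_E12 as @ Cs) (map scaled_E12 as' @ Cs')"
    and as: "first_nonzero_is_one as" "first_nonzero_is_one as'"
    and Cs: "Cs = [] \<or> (\<exists>b Ds. Cs = scaled_E21 b # Ds \<and> b \<noteq> 0)"
    and Cs': "Cs' = [] \<or> (\<exists>b Ds. Cs' = scaled_E21 b # Ds \<and> b \<noteq> 0)"
    and le: "length as \<le> length as'"
  shows "map scaled_E12 as @ Cs = map scaled_E12 as' @ Cs'"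
proof -
  have E12: "g ** scaled_E12 (as!i) = scaled_E12 (as'!i) ** g" if "i < length as" for i
    using list_all2_nthD[OF tw, of i] that le by (simp add: nth_append)
  \<comment> \<open>The two sides of \<open>E12\<close> carry \<open>as!i\<close> times the first
    column of \<open>g\<close> and \<open>as'!i\<close> times its second row; neither can be zero in
    an invertible matrix.\<close>
  have zero_iff: "as!i = 0 \<longleftrightarrow> as'!i = 0" if "i < length as" for i
  proof -
    have "\<not> (g$1$1 = 0 \<and> g$2$1 = 0)" "\<not> (g$2$1 = 0 \<and> g$2$2 = 0)"
      using g by (auto simp: invertible_det_nz det_2)
    with E12[OF that] show ?thesis
      by (auto simp: mat2_simps)
  qed
  obtain n bs where n: "as = replicate n 0 @ 1 # bs"
    using as(1) by (auto simp: first_nonzero_is_one_iff)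
  obtain n' bs' where n': "as' = replicate n' 0 @ 1 # bs'"
    using as(2) by (auto simp: first_nonzero_is_one_iff)
  have "n = n'"
  proof (rule linorder_cases[of n n'])
    assume "n < n'"
    with zero_iff[of n] show ?thesis by (simp add: n n' nth_append)
  next
    assume "n' < n"
    with zero_iff[of n'] show ?thesis by (simp add: n n' nth_append)
  qed
  then have "g ** scaled_E12 1 = scaled_E12 1 ** g"
    using E12[of n] by (simp add: n n' nth_append)
  note gs = intertwine_E12_E12D[OF this g]
  have nth_eq: "as!i = as'!i" if "i < length as" for i
    using E12[OF that] gs by (auto simp: mat2_simps)
  \<comment> \<open>A shorter \<open>as\<close> would match a nonzero multiple of \<open>E21\<close>
    with a multiple of \<open>E12\<close>, but the lower left entry \<open>g$2$2 * b\<close> is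
    nonzero.\<close>
  have len: "length as = length as'"
  proof (rule ccontr)
    assume "length as \<noteq> length as'"
    with le have lt: "length as < length as'" by simp
    then have "Cs \<noteq> []"
      using list_all2_lengthD[OF tw] by auto
    then obtain b Ds where b: "Cs = scaled_E21 b # Ds" "b \<noteq> 0"
      using Cs by blast
    have "g ** scaled_E21 b = scaled_E12 (as' ! length as) ** g"
      using list_all2_nthD[OF tw, of "length as"] lt b by (simp add: nth_append)
    with gs b show False
      by (auto simp: mat2_simps)
  qed
  with nth_eq have eq: "as = as'"
    by (simp add: list_eq_iff_nth_eq)
  have tw': "list_all2 (\<lambda>A B. g ** A = B ** g) Cs Cs'"
    using tw len by (simp add: list_all2_append)
  show ?thesis
  proof (cases "Cs = []")
    case True
    with tw' eq show ?thesis by simp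
  next
    case False
    with tw' Cs Cs' obtain b Ds b' Ds' where b: "Cs = scaled_E21 b # Ds" "b \<noteq> 0"
      "Cs' = scaled_E21 b' # Ds'" "b' \<noteq> 0"
      by auto
    with tw' have "g ** scaled_E21 b = scaled_E21 b' ** g"
      by simp
    \<comment> \<open>The upper left entry of the identity is \<open>g$1$2 * b = 0\<close>. Thus
      \<open>g\<close> is a nonzero scalar matrix, and the rest of the tuple is fixed as
      well.\<close>
    with gs b have "g$1$2 = 0"
      by (auto simp: mat2_simps)
    with gs have "A = B" if "g ** A = B ** g" for A B
      using that by (auto simp: mat2_simps)
    with tw' have "list_all2 (=) Cs Cs'"
      by (auto elim: list_all2_mono)
    with eq show ?thesis
      by (simp add: list.rel_eq)
  qed
qed

text \<open>Separates type (0) from the other types, since conjugation fixes the zero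
  matrix.\<close>

lemma GL2_orbit_replicate_0:
  assumes "Bs \<in> GL2_orbit (replicate m 0)"
  shows "Bs = replicate m 0"
proof -
  have "g ** 0 ** matrix_inv g = 0" for g :: "'a mat2"
    by (simp add: mat2_simps)
  with assms show ?thesis
    by (auto simp: GL2_orbit_def simul_conj_def map_replicate_const)
qed

lemma GL2_orbit_representative_unique:
  assumes "Bs \<in> GL2_orbit As"
    and "As \<in> type0 m \<or> As \<in> type1 m \<or> As \<in> type2 m"
    and "Bs \<in> type0 m \<or> Bs \<in> type1 m \<or> Bs \<in> type2 m"
  shows "As = Bs"
proof (cases "As \<in> type0 m \<or> Bs \<in> type0 m")
  case True
  with assms(1) GL2_orbit_sym[OF assms(1)] show ?thesis
    by (auto simp: type0_def dest: GL2_orbit_replicate_0)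
next
  case False
  obtain as Cs where A: "As = map scaled_E12 as @ Cs" "first_nonzero_is_one as"
    "Cs = [] \<or> (\<exists>b Ds. Cs = scaled_E21 b # Ds \<and> b \<noteq> 0)"
    using assms(2) False type1_or_type2_iff[of As m] by blast
  obtain as' Cs' where B: "Bs = map scaled_E12 as' @ Cs'" "first_nonzero_is_one as'"
    "Cs' = [] \<or> (\<exists>b Ds. Cs' = scaled_E21 b # Ds \<and> b \<noteq> 0)"
    using assms(3) False type1_or_type2_iff[of Bs m] by blast
  show ?thesis
  proof (cases "length as \<le> length as'")
    case True
    with assms(1) A B show ?thesis
      unfolding mem_GL2_orbit_iff using intertwined_normal_forms_eq by metis
  next
    case False
    \<comment> \<open>With the longer prefix in \<open>As\<close>, the roles of the two tuples are
      exchanged by symmetry of the orbit relation.\<close>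
    with GL2_orbit_sym[OF assms(1)] A B show ?thesis
      unfolding mem_GL2_orbit_iff using intertwined_normal_forms_eq nat_le_linear by metis
  qed
qed

theorem theorem3p4:
  fixes m :: nat and Orb :: "'a::field mat2 list set"
  assumes "m \<ge> 1" and "Orb \<in> GL2_orbits m"
  shows "\<exists>!As. As \<in> Orb \<and> (As \<in> type0 m \<or> As \<in> type1 m \<or> As \<in> type2 m)"
proof -
  obtain Xs where Xs: "Orb = GL2_orbit Xs" "Xs \<in> nilp2_tuples m"
    using assms(2) by (auto simp: GL2_orbits_def)
  show ?thesis
  proof (rule ex_ex1I)
    show "\<exists>As. As \<in> Orb \<and> (As \<in> type0 m \<or> As \<in> type1 m \<or> As \<in> type2 m)"
      using GL2_orbit_representative_exists[OF Xs(2)] by (auto simp: Xs(1))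
  next
    fix As Bs
    assume A: "As \<in> Orb \<and> (As \<in> type0 m \<or> As \<in> type1 m \<or> As \<in> type2 m)"
      and B: "Bs \<in> Orb \<and> (Bs \<in> type0 m \<or> Bs \<in> type1 m \<or> Bs \<in> type2 m)"
    then have "Bs \<in> GL2_orbit As"
      unfolding Xs(1) using GL2_orbit_sym GL2_orbit_trans by blast
    with A B show "As = Bs"
      using GL2_orbit_representative_unique by blast
  qed
qed

end
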